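(* Let $K$ be a locally compact, perfectly normal Hausdorff space and let $\mathbb{X}$ be a Banach space over $\mathbb{K}\in\{\mathbb{R},\mathbb{C}\}$. Let $f \in C_0(K,\mathbb{X})$ with $\|f\|=1$. Then $f$ is left symmetric in $C_0(K,\mathbb{X})$ if and only if both of the following hold: (i) there exists $k_0 \in K$ such that $\|f(k_0)\|=1$ and $f(k)=0$ for all $k \in K$ with $k\neq k_0$; (ii) $f(k_0)$ is a left symmetric point of $\mathbb{X}$.
   Context: For a locally compact Hausdorff space $K$, $C_0(K,\mathbb{X})$ is the Banach space (supremum norm) of all bounded continuous functions $f:K\to\mathbb{X}$ such that for every $\epsilon>0$ there is a compact set $\Gamma\subset K$ with $\|f(k)\|<\epsilon$ for all $k\in K\setminus\Gamma$. A topological space is perfectly normal if it is normal and every closed subset is a $G_\delta$ set. For a Banach space $\mathbb{Z}$ over $\mathbb{K}$ and $x,y\in\mathbb{Z}$, $x\perp_B y$ (Birkhoff-James orthogonality) means $\|x+\lambda y\|\ge\|x\|$ for all $\lambda\in\mathbb{K}$. A point $x\in\mathbb{Z}$ is left symmetric (in $\mathbb{Z}$) if for all $y\in\mathbb{Z}$, $x\perp_B y$ implies $y\perp_B x$. *)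

theory Defs
  imports "HOL-Analysis.Analysis"
begin

text \<open>The scalar fields: up to an isometric isomorphism of real algebras, exactly the field of
  real numbers and the field of complex numbers.\<close>

class real_or_complex = real_normed_field +
  assumes ex_real_or_complex_iso:
    "\<exists>\<phi> :: 'a \<Rightarrow> complex.
       (\<forall>a b. \<phi> (a + b) = \<phi> a + \<phi> b) \<and> (\<forall>a b. \<phi> (a * b) = \<phi> a * \<phi> b) \<and>
       (\<forall>r. \<phi> (r *\<^sub>R 1) = of_real r) \<and> (\<forall>a. norm (\<phi> a) = norm a) \<and>
       (range \<phi> = \<real> \<or> range \<phi> = UNIV)"

instance real :: real_or_complex
proof
  show "\<exists>\<phi> :: real \<Rightarrow> complex.
       (\<forall>a b. \<phi> (a + b) = \<phi> a + \<phi> b) \<and> (\<forall>a b. \<phi> (a * b) = \<phi> a * \<phi> b) \<and>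
       (\<forall>r. \<phi> (r *\<^sub>R 1) = of_real r) \<and> (\<forall>a. norm (\<phi> a) = norm a) \<and>
       (range \<phi> = \<real> \<or> range \<phi> = UNIV)"
    by (rule exI[of _ of_real]) (auto simp: Reals_def)
qed

instance complex :: real_or_complex
proof
  show "\<exists>\<phi> :: complex \<Rightarrow> complex.
       (\<forall>a b. \<phi> (a + b) = \<phi> a + \<phi> b) \<and> (\<forall>a b. \<phi> (a * b) = \<phi> a * \<phi> b) \<and>
       (\<forall>r. \<phi> (r *\<^sub>R 1) = of_real r) \<and> (\<forall>a. norm (\<phi> a) = norm a) \<and>
       (range \<phi> = \<real> \<or> range \<phi> = UNIV)"
    by (rule exI[of _ "\<lambda>z. z"]) (auto simp: scaleR_conv_of_real)
qed

text \<open>A normed space over such a field. Addition and norm come from the class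
  \<open>real_normed_vector\<close>, which also carries the real scalar multiplication; \<open>smul\<close> has to extend
  the latter. Over the reals this forces \<open>smul\<close> to be \<open>scaleR\<close>. Completeness does not depend on the
  scalars: a Banach space is such a structure on a type of class \<open>banach\<close>.\<close>

locale normed_space_over = vector_space smul
  for smul :: "'s::real_or_complex \<Rightarrow> 'x::real_normed_vector \<Rightarrow> 'x" +
  assumes norm_smul: "norm (smul c x) = norm c * norm x"
    and smul_of_real: "smul (of_real r) x = r *\<^sub>R x"

lemma normed_space_over_scaleR: "normed_space_over (scaleR :: real \<Rightarrow> 'x::real_normed_vector \<Rightarrow> 'x)"
  by unfold_locales (auto simp: scaleR_add_right scaleR_add_left)

lemma normed_space_over_complex: "normed_space_over ((*) :: complex \<Rightarrow> complex \<Rightarrow> complex)"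
  by unfold_locales (auto simp: algebra_simps norm_mult scaleR_conv_of_real)

definition smul_bcontfun ::
    "('s \<Rightarrow> 'x \<Rightarrow> 'x) \<Rightarrow> 's \<Rightarrow> ('k::topological_space \<Rightarrow>\<^sub>C 'x::metric_space) \<Rightarrow> ('k \<Rightarrow>\<^sub>C 'x)"
  where "smul_bcontfun smul c f = Bcontfun (\<lambda>k. smul c (apply_bcontfun f k))"

text \<open>The norm of \<open>C\<^sub>0(K, X)\<close> is the supremum norm inherited from the type of bounded continuous
  functions.\<close>

definition C0 :: "('k::topological_space \<Rightarrow>\<^sub>C 'x::real_normed_vector) set"
  where "C0 = {f. \<forall>\<epsilon>>0. \<exists>\<Gamma>. compact \<Gamma> \<and> (\<forall>k. k \<notin> \<Gamma> \<longrightarrow> norm (apply_bcontfun f k) < \<epsilon>)}"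

definition perfectly_normal_space :: "'k topology \<Rightarrow> bool"
  where "perfectly_normal_space T \<longleftrightarrow>
    normal_space T \<and> (\<forall>C. closedin T C \<longrightarrow> gdelta_in T C)"

definition bj_orthogonal ::
    "('s \<Rightarrow> 'z \<Rightarrow> 'z) \<Rightarrow> 'z::real_normed_vector \<Rightarrow> 'z \<Rightarrow> bool"
  where "bj_orthogonal smul x y \<longleftrightarrow> (\<forall>c. norm (x + smul c y) \<ge> norm x)"

text \<open>Here \<open>Z\<close> is the underlying set of the space, so that the notion also applies to a
  closed subspace of the ambient type.\<close>

definition left_symmetric ::
    "('s \<Rightarrow> 'z \<Rightarrow> 'z) \<Rightarrow> 'z::real_normed_vector set \<Rightarrow> 'z \<Rightarrow> bool"
  where "left_symmetric smul Z x \<longleftrightarrow>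
    x \<in> Z \<and> (\<forall>y\<in>Z. bj_orthogonal smul x y \<longrightarrow> bj_orthogonal smul y x)"

context normed_space_over
begin

lemma bounded_linear_smul: "bounded_linear (smul c)"
proof
  show "smul c (x + y) = smul c x + smul c y" for x y
    by (rule scale_right_distrib)
  show "smul c (r *\<^sub>R x) = r *\<^sub>R smul c x" for r x
    by (metis smul_of_real scale_left_commute)
  show "\<exists>K. \<forall>x. norm (smul c x) \<le> norm x * K"
    by (rule exI[of _ "norm c"]) (simp add: norm_smul mult.commute)
qed

lemma apply_smul_bcontfun [simp]:
  fixes f :: "'k::topological_space \<Rightarrow>\<^sub>C 'x"
  shows "apply_bcontfun (smul_bcontfun smul c f) k = smul c (apply_bcontfun f k)"
proof -
  have "continuous_on UNIV (\<lambda>k. smul c (apply_bcontfun f k))"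
    by (rule bounded_linear.continuous_on[OF bounded_linear_smul]) simp
  moreover have "bounded (range (\<lambda>k. smul c (apply_bcontfun f k)))"
    using bounded_linear_image[OF bounded_apply_bcontfun[of f] bounded_linear_smul[of c]]
    by (simp add: image_image)
  ultimately show ?thesis
    by (simp add: smul_bcontfun_def Bcontfun_inverse bcontfun_def)
qed

lemma normed_space_over_smul_bcontfun:
  "normed_space_over (smul_bcontfun smul :: _ \<Rightarrow> ('k::topological_space \<Rightarrow>\<^sub>C 'x) \<Rightarrow> _)"
proof
  fix c d and f g :: "'k \<Rightarrow>\<^sub>C 'x" and r
  show "smul_bcontfun smul c (f + g) = smul_bcontfun smul c f + smul_bcontfun smul c g"
    by (rule bcontfun_eqI) (simp add: plus_bcontfun.rep_eq scale_right_distrib)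
  show "smul_bcontfun smul (c + d) f = smul_bcontfun smul c f + smul_bcontfun smul d f"
    by (rule bcontfun_eqI) (simp add: plus_bcontfun.rep_eq scale_left_distrib)
  show "smul_bcontfun smul c (smul_bcontfun smul d f) = smul_bcontfun smul (c * d) f"
    by (rule bcontfun_eqI) simp
  show "smul_bcontfun smul 1 f = f"
    by (rule bcontfun_eqI) simp
  show "smul_bcontfun smul (of_real r) f = r *\<^sub>R f"
    by (rule bcontfun_eqI) (simp add: smul_of_real)
  have le: "norm (smul_bcontfun smul a h) \<le> norm a * norm h" for a and h :: "'k \<Rightarrow>\<^sub>C 'x"
    by (rule norm_bound) (simp add: norm_smul norm_bounded mult_left_mono)
  show "norm (smul_bcontfun smul c f) = norm c * norm f"
  proof (cases "c = 0")
    case True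
    then show ?thesis using le[of 0 f] by simp
  next
    case False
    have "smul_bcontfun smul (inverse c) (smul_bcontfun smul c f) = f"
      by (rule bcontfun_eqI) (simp add: False)
    then have "norm f \<le> norm (inverse c) * norm (smul_bcontfun smul c f)"
      using le[of "inverse c" "smul_bcontfun smul c f"] by simp
    then have "norm c * norm f \<le> norm (smul_bcontfun smul c f)"
      using False unfolding norm_inverse by (simp add: field_simps)
    with le[of c f] show ?thesis by simp
  qed
qed

lemma subspace_C0:
  "module.subspace (smul_bcontfun smul) (C0 :: ('k::topological_space \<Rightarrow>\<^sub>C 'x) set)"
proof -
  interpret b: normed_space_over "smul_bcontfun smul :: _ \<Rightarrow> ('k \<Rightarrow>\<^sub>C 'x) \<Rightarrow> _"
    by (rule normed_space_over_smul_bcontfun)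
  show ?thesis
  proof (rule b.subspaceI)
    show "(0 :: 'k \<Rightarrow>\<^sub>C 'x) \<in> C0"
      by (auto simp: C0_def intro: exI[of _ "{}"])
  next
    fix f g :: "'k \<Rightarrow>\<^sub>C 'x"
    assume f: "f \<in> C0" and g: "g \<in> C0"
    show "f + g \<in> C0"
      unfolding C0_def
    proof (intro CollectI allI impI)
      fix e :: real
      assume "e > 0"
      then have "e / 2 > 0" by simp
      then obtain A B where
        A: "compact A" "\<And>k. k \<notin> A \<Longrightarrow> norm (apply_bcontfun f k) < e / 2" and
        B: "compact B" "\<And>k. k \<notin> B \<Longrightarrow> norm (apply_bcontfun g k) < e / 2"
        using f g unfolding C0_def mem_Collect_eq by metis
      have "norm (apply_bcontfun (f + g) k) < e" if "k \<notin> A \<union> B" for k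
        using norm_triangle_ineq[of "apply_bcontfun f k" "apply_bcontfun g k"] A(2)[of k] B(2)[of k] that
        by (simp add: plus_bcontfun.rep_eq)
      then show "\<exists>\<Gamma>. compact \<Gamma> \<and> (\<forall>k. k \<notin> \<Gamma> \<longrightarrow> norm (apply_bcontfun (f + g) k) < e)"
        using compact_Un[OF A(1) B(1)] by blast
    qed
  next
    fix c and f :: "'k \<Rightarrow>\<^sub>C 'x"
    assume f: "f \<in> C0"
    show "smul_bcontfun smul c f \<in> C0"
      unfolding C0_def
    proof (intro CollectI allI impI)
      fix e :: real
      assume "e > 0"
      then have "e / (norm c + 1) > 0"
        by (simp add: add_nonneg_pos)
      then obtain A where
        A: "compact A" "\<And>k. k \<notin> A \<Longrightarrow> norm (apply_bcontfun f k) < e / (norm c + 1)"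
        using f unfolding C0_def mem_Collect_eq by metis
      have "norm (apply_bcontfun (smul_bcontfun smul c f) k) < e" if "k \<notin> A" for k
      proof -
        have "norm c * norm (apply_bcontfun f k) \<le> (norm c + 1) * norm (apply_bcontfun f k)"
          by (simp add: mult_right_mono)
        also have "\<dots> < e"
          using A(2)[OF that] norm_ge_zero[of c] by (simp add: field_simps add_nonneg_pos)
        finally show ?thesis by (simp add: norm_smul)
      qed
      then show "\<exists>\<Gamma>. compact \<Gamma> \<and>
          (\<forall>k. k \<notin> \<Gamma> \<longrightarrow> norm (apply_bcontfun (smul_bcontfun smul c f) k) < e)"
        using A(1) by blast
    qed
  qed
qed

end

end

theory Submission
  imports Defs
begin

text \<open>If \<open>f\<close> attains its norm at \<open>k\<^sub>0\<close> and is nonzero at some \<open>k\<^sub>1 \<noteq> k\<^sub>0\<close>, take a continuous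
  \<open>\<phi> : K \<rightarrow> [0, 1]\<close> with \<open>\<phi> k\<^sub>0 = 0\<close> and \<open>\<phi> k\<^sub>1 = 1\<close>. Then \<open>f\<close> is orthogonal to \<open>\<phi> f\<close>, which vanishes
  at \<open>k\<^sub>0\<close>, while subtracting a small positive multiple of \<open>f\<close> shrinks the norm of \<open>\<phi> f\<close>; so \<open>f\<close> is
  not left symmetric. If \<open>f\<close> is supported at a single, hence isolated, point \<open>k\<^sub>0\<close>, then
  orthogonality between \<open>f\<close> and any \<open>g\<close> reduces to the values at \<open>k\<^sub>0\<close>: by convexity of the norm only
  small scalars matter for \<open>f \<bottom> g\<close>, and for those \<open>f + c g\<close> has norm below \<open>\<parallel>f\<parallel>\<close> away from \<open>k\<^sub>0\<close>;
  conversely \<open>g + c f\<close> agrees with \<open>g\<close> away from \<open>k\<^sub>0\<close>.\<close>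

section \<open>Birkhoff-James orthogonality in the value space and in the supremum norm\<close>

context normed_space_over
begin

text \<open>For 0 < t \<le> 1 the vector \<open>x + t c y\<close> is a convex combination of
  \<open>x\<close> and \<open>x + c y\<close>, so a norm below \<open>norm x\<close> at
  \<open>c\<close> would persist at \<open>t c\<close>, however small \<open>t\<close> is.\<close>

lemma bj_orthogonal_if_small:
  assumes "\<delta> > 0" and small: "\<And>c. norm c < \<delta> \<Longrightarrow> norm x \<le> norm (x + smul c y)"
  shows "bj_orthogonal smul x y"
  unfolding bj_orthogonal_def
proof
  fix c :: 's
  \<comment> \<open>The cap 1 keeps the combination convex; the other term makes
    \<open>t * norm c\<close> smaller than \<delta>, with \<open>norm c + 1\<close> allowing for
    \<open>c = 0\<close>.\<close>
  define t where "t = min 1 (\<delta> / (2 * (norm c + 1)))"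
  have pos: "norm c + 1 > 0"
    by (simp add: add_nonneg_pos)
  then have t: "0 < t" "t \<le> 1"
    using \<open>\<delta> > 0\<close> by (auto simp: t_def)
  have "t * norm c \<le> \<delta> / (2 * (norm c + 1)) * norm c"
    by (intro mult_right_mono) (auto simp: t_def)
  also have "\<dots> < \<delta>"
    using mult_strict_left_mono[OF _ \<open>\<delta> > 0\<close>, of "norm c" "2 * (norm c + 1)"] pos
    by (simp add: field_simps)
  finally have "norm (of_real t * c) < \<delta>"
    using t by (simp add: norm_mult)
  then have "norm x \<le> norm (x + smul (of_real t * c) y)"
    by (rule small)
  also have "x + smul (of_real t * c) y = (1 - t) *\<^sub>R x + t *\<^sub>R (x + smul c y)"
    by (simp flip: scale_scale add: smul_of_real algebra_simps
        linear_scale[OF bounded_linear.linear[OF bounded_linear_smul]])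
  also have "norm \<dots> \<le> (1 - t) * norm x + t * norm (x + smul c y)"
    using t norm_triangle_ineq[of "(1 - t) *\<^sub>R x" "t *\<^sub>R (x + smul c y)"] by simp
  finally have "t * norm x \<le> t * norm (x + smul c y)"
    by (simp add: algebra_simps)
  then show "norm x \<le> norm (x + smul c y)"
    using t by simp
qed

lemma bj_orthogonal_bcontfun_vanishing:
  fixes f g :: "'k::topological_space \<Rightarrow>\<^sub>C 'x"
  assumes "norm (apply_bcontfun f k) = norm f" "apply_bcontfun g k = 0"
  shows "bj_orthogonal (smul_bcontfun smul) f g"
  unfolding bj_orthogonal_def
proof
  fix c
  show "norm f \<le> norm (f + smul_bcontfun smul c g)"
    using norm_bounded[of "f + smul_bcontfun smul c g" k] assms
    by (simp add: plus_bcontfun.rep_eq)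
qed

text \<open>With \<open>s = norm g\<close>, the function \<open>g - (s/2) f\<close> has pointwise
  norm at most \<open>s/2\<close> wherever \<phi> or the norm of \<open>f\<close> is at most
  \<open>s/2\<close>; elsewhere the subtraction lowers the norm of \<open>g\<close> by at least
  \<open>(s/2)^2\<close>. Both resulting bounds lie below \<open>s\<close>.\<close>

lemma not_bj_orthogonal_multiplier:
  fixes f g :: "'k::topological_space \<Rightarrow>\<^sub>C 'x"
  assumes \<phi>: "\<And>k. 0 \<le> \<phi> k" "\<And>k. \<phi> k \<le> 1"
    and g: "\<And>k. apply_bcontfun g k = \<phi> k *\<^sub>R apply_bcontfun f k"
    and "norm f = 1" "g \<noteq> 0"
  shows "\<not> bj_orthogonal (smul_bcontfun smul) g f"
proof
  define s where "s = norm g"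
  have "s > 0"
    using \<open>g \<noteq> 0\<close> by (simp add: s_def)
  assume "bj_orthogonal (smul_bcontfun smul) g f"
  then have "s \<le> norm (g + smul_bcontfun smul (of_real (- (s / 2))) f)"
    unfolding bj_orthogonal_def s_def by blast
  also have "\<dots> \<le> max (s - s / 2 * (s / 2)) (s / 2)"
  proof (rule norm_bound)
    fix k
    let ?n = "norm (apply_bcontfun f k)"
    have n: "0 \<le> ?n" "?n \<le> 1"
      using norm_bounded[of f k] \<open>norm f = 1\<close> by auto
    have gk: "\<phi> k * ?n \<le> s"
      using norm_bounded[of g k] \<phi>(1)[of k] by (simp add: g s_def)
    have "apply_bcontfun (g + smul_bcontfun smul (of_real (- (s / 2))) f) k
        = (\<phi> k - s / 2) *\<^sub>R apply_bcontfun f k"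
      unfolding plus_bcontfun.rep_eq apply_smul_bcontfun g smul_of_real
      by (simp add: algebra_simps)
    then have eq: "norm (apply_bcontfun (g + smul_bcontfun smul (of_real (- (s / 2))) f) k)
        = \<bar>\<phi> k - s / 2\<bar> * ?n"
      by simp
    have "\<bar>\<phi> k - s / 2\<bar> * ?n \<le> max (s - s / 2 * (s / 2)) (s / 2)"
    proof (cases "\<phi> k \<le> s / 2")
      case True
      then have "\<bar>\<phi> k - s / 2\<bar> * ?n \<le> (s / 2) * 1"
        using n \<phi>(1)[of k] by (intro mult_mono) auto
      then show ?thesis by simp
    next
      case large: False
      then have e: "\<bar>\<phi> k - s / 2\<bar> * ?n = \<phi> k * ?n - s / 2 * ?n"
        by (simp add: algebra_simps)
      show ?thesis
      proof (cases "?n \<le> s / 2")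
        case True
        have "\<phi> k * ?n \<le> ?n"
          using n \<phi>(2)[of k] by (simp add: mult_left_le_one_le \<phi>)
        moreover have "0 \<le> s / 2 * ?n"
          using \<open>s > 0\<close> by simp
        ultimately show ?thesis
          using True e by linarith
      next
        case False
        then have "s / 2 * (s / 2) \<le> s / 2 * ?n"
          using \<open>s > 0\<close> by (intro mult_left_mono) auto
        then show ?thesis
          using e gk by linarith
      qed
    qed
    then show "norm (apply_bcontfun (g + smul_bcontfun smul (of_real (- (s / 2))) f) k)
        \<le> max (s - s / 2 * (s / 2)) (s / 2)"
      by (simp only: eq)
  qed
  also have "\<dots> < s"
    using \<open>s > 0\<close> by simp
  finally show False by simp
qed

text \<open>If \<open>norm c * norm g < norm f\<close>, the values of \<open>f + c g\<close> away
  from \<open>k\<close> stay below \<open>norm f\<close>, so the value at \<open>k\<close> must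
  reach it. The lemma serves both for the given \<open>f\<close> and, with roles exchanged, for a
  test function supported at \<open>k\<close>.\<close>

lemma bj_orthogonal_at_point:
  fixes f g :: "'k::topological_space \<Rightarrow>\<^sub>C 'x"
  assumes f: "\<And>j. j \<noteq> k \<Longrightarrow> apply_bcontfun f j = 0" and "f \<noteq> 0"
    and orth: "bj_orthogonal (smul_bcontfun smul) f g"
  shows "bj_orthogonal smul (apply_bcontfun f k) (apply_bcontfun g k)"
proof (rule bj_orthogonal_if_small)
  have pos: "norm g + 1 > 0"
    by (simp add: add_nonneg_pos)
  then show "norm f / (norm g + 1) > 0"
    using \<open>f \<noteq> 0\<close> by simp
  fix c :: 's
  assume "norm c < norm f / (norm g + 1)"
  then have c: "norm c * norm g < norm f"
    using pos norm_ge_zero[of c] unfolding pos_less_divide_eq[OF pos] distrib_left by linarith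
  let ?m = "norm (apply_bcontfun f k + smul c (apply_bcontfun g k))"
  have "norm f \<le> norm (f + smul_bcontfun smul c g)"
    using orth by (simp add: bj_orthogonal_def)
  also have "\<dots> \<le> max ?m (norm c * norm g)"
  proof (rule norm_bound)
    fix j
    show "norm (apply_bcontfun (f + smul_bcontfun smul c g) j) \<le> max ?m (norm c * norm g)"
    proof (cases "j = k")
      case False
      have "norm c * norm (apply_bcontfun g j) \<le> norm c * norm g"
        by (intro mult_left_mono norm_bounded) simp
      then show ?thesis
        using False f by (simp add: plus_bcontfun.rep_eq norm_smul)
    qed (simp add: plus_bcontfun.rep_eq)
  qed
  finally show "norm (apply_bcontfun f k) \<le> ?m"
    using c norm_bounded[of f k] by linarith
qed

text \<open>The comparison is pointwise because \<open>g\<close> may have its supremum away from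
  \<open>k\<close>, where adding a multiple of \<open>f\<close> changes nothing.\<close>

lemma bj_orthogonal_from_point:
  fixes f g :: "'k::topological_space \<Rightarrow>\<^sub>C 'x"
  assumes f: "\<And>j. j \<noteq> k \<Longrightarrow> apply_bcontfun f j = 0"
    and orth: "bj_orthogonal smul (apply_bcontfun g k) (apply_bcontfun f k)"
  shows "bj_orthogonal (smul_bcontfun smul) g f"
  unfolding bj_orthogonal_def
proof (intro allI norm_bound)
  fix c j
  have "norm (apply_bcontfun g j) \<le> norm (apply_bcontfun (g + smul_bcontfun smul c f) j)"
    using f[of j] orth by (cases "j = k") (auto simp: plus_bcontfun.rep_eq bj_orthogonal_def)
  also have "\<dots> \<le> norm (g + smul_bcontfun smul c f)"
    by (rule norm_bounded)
  finally show "norm (apply_bcontfun g j) \<le> norm (g + smul_bcontfun smul c f)" .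
qed

end

section \<open>Functions vanishing at infinity\<close>

lemma C0_norm_attained:
  assumes "f \<in> C0" "f \<noteq> 0"
  obtains k where "norm (apply_bcontfun f k) = norm f"
proof -
  \<comment> \<open>Outside the compact set for this tolerance \<open>f\<close> stays below half its
    norm, so the supremum is a maximum over that set.\<close>
  have "norm f / 2 > 0"
    using \<open>f \<noteq> 0\<close> by simp
  then obtain \<Gamma> where \<Gamma>: "compact \<Gamma>" "\<And>k. k \<notin> \<Gamma> \<Longrightarrow> norm (apply_bcontfun f k) < norm f / 2"
    using \<open>f \<in> C0\<close> unfolding C0_def mem_Collect_eq by metis
  have "\<Gamma> \<noteq> {}"
  proof
    assume "\<Gamma> = {}"
    then have "norm f \<le> norm f / 2"
      using \<Gamma>(2) by (intro norm_bound) (auto intro: less_imp_le)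
    then show False
      using \<open>f \<noteq> 0\<close> by simp
  qed
  moreover have "continuous_on \<Gamma> (\<lambda>k. norm (apply_bcontfun f k))"
    by (intro continuous_on_norm continuous_on_subset[OF continuous_on_apply_bcontfun]) auto
  ultimately obtain k where
    k: "\<And>j. j \<in> \<Gamma> \<Longrightarrow> norm (apply_bcontfun f j) \<le> norm (apply_bcontfun f k)"
    using continuous_attains_sup[OF \<Gamma>(1)] by metis
  have "norm f \<le> max (norm (apply_bcontfun f k)) (norm f / 2)"
    using k \<Gamma>(2) by (intro norm_bound) (meson less_imp_le max.coboundedI1 max.coboundedI2)
  then have "norm (apply_bcontfun f k) = norm f"
    using norm_bounded[of f k] \<open>norm f / 2 > 0\<close> by linarith
  then show thesis
    by (rule that)
qed

lemma C0_dominated: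
  assumes "f \<in> C0" "\<And>k. norm (apply_bcontfun g k) \<le> norm (apply_bcontfun f k)"
  shows "g \<in> C0"
  using assms unfolding C0_def mem_Collect_eq by (meson le_less_trans)

text \<open>In a Hausdorff space \<open>{k}\<close> is closed; being also open, it splits the space
  into two open pieces on which the function is constant. The compact set \<open>{k}\<close> serves
  every \<epsilon>.\<close>

lemma C0_isolated_point:
  fixes k :: "'k::t2_space" and y :: "'x::real_normed_vector"
  assumes "open {k}"
  obtains g where "g \<in> C0" "\<And>j. apply_bcontfun g j = (if j = k then y else 0)"
proof -
  let ?h = "\<lambda>j. if j = k then y else 0"
  have "continuous_on ({k} \<union> - {k}) ?h"
  proof (rule continuous_on_open_Un)
    show "continuous_on (- {k}) ?h"
      by (rule continuous_on_eq[OF continuous_on_const[of _ 0]]) auto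
  qed (use assms in auto)
  then have "?h \<in> bcontfun"
    by (auto simp: bcontfun_def intro!: finite_imp_bounded finite_subset[of _ "{y, 0}"])
  then have g: "apply_bcontfun (Bcontfun ?h) j = ?h j" for j
    by (simp add: Bcontfun_inverse)
  show thesis
  proof (rule that)
    show "apply_bcontfun (Bcontfun ?h) j = ?h j" for j
      by (rule g)
    show "Bcontfun ?h \<in> C0"
      unfolding C0_def mem_Collect_eq g by (auto intro!: exI[of _ "{k}"])
  qed
qed

lemma open_singleton_support:
  fixes f :: "'k::topological_space \<Rightarrow>\<^sub>C 'x::real_normed_vector"
  assumes "apply_bcontfun f k \<noteq> 0" "\<And>j. j \<noteq> k \<Longrightarrow> apply_bcontfun f j = 0"
  shows "open {k}"
proof -
  have "open (apply_bcontfun f -` (- {0}))"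
    by (intro open_vimage) (auto simp: closed_singleton)
  also have "apply_bcontfun f -` (- {0}) = {k}"
    using assms by auto
  finally show ?thesis .
qed

section \<open>Left symmetry and its reduction to one point\<close>

lemma (in normed_space_over) left_symmetric_imp_singleton_support:
  fixes f :: "'k::t2_space \<Rightarrow>\<^sub>C 'x"
  assumes "normal_space (euclidean :: 'k topology)"
    and sym: "left_symmetric (smul_bcontfun smul) C0 f"
    and "norm f = 1" and k0: "norm (apply_bcontfun f k0) = 1" and "k1 \<noteq> k0"
  shows "apply_bcontfun f k1 = 0"
proof (rule ccontr)
  assume nz: "apply_bcontfun f k1 \<noteq> 0"
  \<comment> \<open>Urysohn's lemma applies since points of a Hausdorff space are closed.\<close>
  obtain \<phi> where cont: "continuous_map euclidean (top_of_set {0..1::real}) \<phi>"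
    and \<phi>01: "\<phi> ` {k0} \<subseteq> {0}" "\<phi> ` {k1} \<subseteq> {1}"
    using Urysohn_lemma[OF assms(1), of "{k0}" "{k1}" 0 1] \<open>k1 \<noteq> k0\<close> by (auto simp: disjnt_def)
  have \<phi>: "0 \<le> \<phi> k" "\<phi> k \<le> 1" for k
    using cont by (auto simp: continuous_map_in_subtopology image_subset_iff)
  have "continuous_on UNIV \<phi>"
    using cont by (simp add: continuous_map_in_subtopology)
  then have "continuous_on UNIV (\<lambda>k. \<phi> k *\<^sub>R apply_bcontfun f k)"
    by (intro continuous_intros) auto
  \<comment> \<open>This bound gives both boundedness of the product and its membership in
    \<open>C0\<close>.\<close>
  moreover have le: "norm (\<phi> k *\<^sub>R apply_bcontfun f k) \<le> norm (apply_bcontfun f k)" for k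
    using \<phi>[of k] by (simp add: mult_left_le_one_le)
  have "bounded (range (\<lambda>k. \<phi> k *\<^sub>R apply_bcontfun f k))"
    by (auto simp: bounded_iff intro!: exI[of _ "norm f"] order_trans[OF le norm_bounded]
        simp del: norm_scaleR)
  ultimately have "(\<lambda>k. \<phi> k *\<^sub>R apply_bcontfun f k) \<in> bcontfun"
    by (simp add: bcontfun_def)
  then obtain g where g: "\<And>k. apply_bcontfun g k = \<phi> k *\<^sub>R apply_bcontfun f k"
    using Bcontfun_inverse by metis
  have "f \<in> C0"
    using sym by (simp add: left_symmetric_def)
  then have "g \<in> C0"
    by (rule C0_dominated) (simp only: g le)
  moreover have "bj_orthogonal (smul_bcontfun smul) f g"
    using k0 \<phi>01 by (intro bj_orthogonal_bcontfun_vanishing[of f k0]) (auto simp: g \<open>norm f = 1\<close>)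
  moreover have "apply_bcontfun g k1 \<noteq> 0"
    using \<phi>01 nz by (simp add: g)
  then have "g \<noteq> 0"
    by auto
  then have "\<not> bj_orthogonal (smul_bcontfun smul) g f"
    by (rule not_bj_orthogonal_multiplier[OF \<phi> g \<open>norm f = 1\<close>])
  ultimately show False
    using sym by (simp add: left_symmetric_def)
qed

text \<open>By continuity of \<open>f\<close> the point \<open>k\<close> is isolated, so every
  vector \<open>y\<close> extends by zero to a test function in \<open>C0\<close>.\<close>

lemma (in normed_space_over) left_symmetric_iff_at_point:
  fixes f :: "'k::t2_space \<Rightarrow>\<^sub>C 'x"
  assumes "f \<in> C0" and nz: "apply_bcontfun f k \<noteq> 0"
    and f: "\<And>j. j \<noteq> k \<Longrightarrow> apply_bcontfun f j = 0"
  shows "left_symmetric (smul_bcontfun smul) C0 f \<longleftrightarrow> left_symmetric smul UNIV (apply_bcontfun f k)"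
proof
  have "f \<noteq> 0"
    using nz by auto
  show "left_symmetric smul UNIV (apply_bcontfun f k)"
    if sym: "left_symmetric (smul_bcontfun smul) C0 f"
    unfolding left_symmetric_def
  proof (intro conjI ballI impI)
    fix y
    assume orth: "bj_orthogonal smul (apply_bcontfun f k) y"
    obtain g where "g \<in> C0" and g: "\<And>j. apply_bcontfun g j = (if j = k then y else 0)"
      using C0_isolated_point[OF open_singleton_support[OF nz f]] by metis
    have "bj_orthogonal (smul_bcontfun smul) f g"
      by (rule bj_orthogonal_from_point[of k]) (use g orth in auto)
    then have "bj_orthogonal (smul_bcontfun smul) g f"
      using sym \<open>g \<in> C0\<close> by (simp add: left_symmetric_def)
    then show "bj_orthogonal smul y (apply_bcontfun f k)"
    \<comment> \<open>Passing to the value at \<open>k\<close> requires \<open>g \<noteq> 0\<close>;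
      the zero vector is orthogonal to everything.\<close>
    proof (cases "y = 0")
      case False
      then have "g \<noteq> 0"
        using g[of k] by auto
      then show ?thesis
        using bj_orthogonal_at_point[of k g f] g \<open>bj_orthogonal (smul_bcontfun smul) g f\<close> by simp
    qed (simp add: bj_orthogonal_def)
  qed simp
  show "left_symmetric (smul_bcontfun smul) C0 f"
    if sym: "left_symmetric smul UNIV (apply_bcontfun f k)"
    unfolding left_symmetric_def
  proof (intro conjI ballI impI)
    fix g :: "'k \<Rightarrow>\<^sub>C 'x"
    assume "bj_orthogonal (smul_bcontfun smul) f g"
    then have "bj_orthogonal smul (apply_bcontfun f k) (apply_bcontfun g k)"
      using bj_orthogonal_at_point f \<open>f \<noteq> 0\<close> by blast
    then have "bj_orthogonal smul (apply_bcontfun g k) (apply_bcontfun f k)"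
      using sym by (simp add: left_symmetric_def)
    then show "bj_orthogonal (smul_bcontfun smul) g f"
      using bj_orthogonal_from_point f by blast
  qed (rule \<open>f \<in> C0\<close>)
qed

theorem theorem3p3:
  fixes smul :: "'s::real_or_complex \<Rightarrow> 'x::banach \<Rightarrow> 'x"
    and f :: "'k::t2_space \<Rightarrow>\<^sub>C 'x"
  assumes "normed_space_over smul"
    and "locally_compact_space (euclidean :: 'k topology)"
    and "perfectly_normal_space (euclidean :: 'k topology)"
    and "f \<in> C0"
    and "norm f = 1"
  shows "left_symmetric (smul_bcontfun smul) C0 f \<longleftrightarrow>
    (\<exists>k\<^sub>0. norm (apply_bcontfun f k\<^sub>0) = 1 \<and>
          (\<forall>k. k \<noteq> k\<^sub>0 \<longrightarrow> apply_bcontfun f k = 0) \<and>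
          left_symmetric smul UNIV (apply_bcontfun f k\<^sub>0))"
proof -
  interpret normed_space_over smul by fact
  have normal: "normal_space (euclidean :: 'k topology)"
    using assms(3) by (simp add: perfectly_normal_space_def)
  \<comment> \<open>Stated for every \<open>k\<close>, since the witness on the right-hand side is
    arbitrary.\<close>
  have iff: "left_symmetric (smul_bcontfun smul) C0 f \<longleftrightarrow> left_symmetric smul UNIV (apply_bcontfun f k)"
    if "norm (apply_bcontfun f k) = 1" "\<And>j. j \<noteq> k \<Longrightarrow> apply_bcontfun f j = 0" for k
    using that by (intro left_symmetric_iff_at_point \<open>f \<in> C0\<close>) auto
  have "f \<noteq> 0"
    using \<open>norm f = 1\<close> by auto
  then obtain k0 where k0: "norm (apply_bcontfun f k0) = 1"
    using C0_norm_attained[OF \<open>f \<in> C0\<close>] \<open>norm f = 1\<close> by metis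
  \<comment> \<open>From left to right, the point \<open>k0\<close> where the norm is attained is
    the witness.\<close>
  show ?thesis
    using left_symmetric_imp_singleton_support[OF normal _ \<open>norm f = 1\<close> k0] iff k0 by metis
qed

end
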